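(* Let $n\ge 1$ and let $I=(i_1,\ldots,i_r)$ be a composition of $n$. Let $D_I$ be the set of permutations $\sigma\in\mathfrak S_n$ whose descent set $\{j\in[1,n-1] : \sigma(j)>\sigma(j+1)\}$ equals $\{i_1,\, i_1+i_2,\,\ldots,\, i_1+\cdots+i_{r-1}\}$. Then $$\sum_{\sigma\in D_I} x_{\operatorname{Mc}(\sigma^{-1})}=\sum_{\sigma\in D_I} x_{\operatorname{Ic}(\sigma^{-1})}=r_I(\mathbf X_I).$$ Equivalently, the nondecreasing rearrangements of $\operatorname{Mc}(\sigma^{-1})$ and of $\operatorname{Ic}(\sigma^{-1})$ have the same distribution when $\sigma$ runs over $D_I$.
   Context: Permutations are written as words $\sigma=\sigma(1)\cdots\sigma(n)$. The $x_0,x_1,x_2,\ldots$ are commuting indeterminates, and for a sequence $c=(c_1,\ldots,c_n)$ of nonnegative integers, $x_c=x_{c_1}x_{c_2}\cdots x_{c_n}$. For $m\ge 0$ let $X_m=\{x_0,\ldots,x_m\}$ and let $h_k(X_m)$ be the complete homogeneous symmetric polynomial of degree $k$ in $x_0,\ldots,x_m$ (with $h_0=1$). Invcode: for $\sigma\in\mathfrak S_n$, $\operatorname{Ic}(\sigma)=(a_1,\ldots,a_n)$ where $a_i$ is the number of values greater than $i$ lying to the left of $i$ in $\sigma$. Majcode: the major index of a word $w=w_1\cdots w_m$ of integers is $\operatorname{maj}(w)=\sum_{j:\,w_j>w_{j+1}} j$. For $\sigma\in\mathfrak S_n$ let $\sigma^{(i)}$ be the subword of $\sigma$ obtained by erasing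 the letters smaller than $i$. Then $\operatorname{Mc}(\sigma)=(c_1,\ldots,c_n)$ with $c_n=0$ and $c_i=\operatorname{maj}(\sigma^{(i)})-\operatorname{maj}(\sigma^{(i+1)})$ for $1\le i\le n-1$. Flagged ribbon Schur function: writing $s_q=i_1+\cdots+i_q$, $r_I(\mathbf X_I)$ is the determinant of the $r\times r$ matrix $M$ with $M_{p,q}=h_{i_p+i_{p+1}+\cdots+i_q}(X_{n-s_q})$ for $q\ge p$, $M_{q+1,q}=1$, and $M_{p,q}=0$ for $p>q+1$. *)

theory Defs
  imports
    "HOL-Library.Poly_Mapping"
    "HOL-Combinatorics.Permutations"
    "Jordan_Normal_Form.Determinant"
begin

text \<open>
  The polynomial ring over the integers in \<open>x\<^sub>0, x\<^sub>1, x\<^sub>2, \<dots>\<close>: finitely supported integer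
  coefficients on monomials, a monomial being a finitely supported exponent vector.
\<close>

type_synonym ipoly = "(nat \<Rightarrow>\<^sub>0 nat) \<Rightarrow>\<^sub>0 int"

definition indet :: "nat \<Rightarrow> ipoly" where
  "indet i = Poly_Mapping.single (Poly_Mapping.single i 1) 1"

definition x_seq :: "nat list \<Rightarrow> ipoly" where
  "x_seq c = prod_list (map indet c)"

definition complete_hom :: "nat \<Rightarrow> nat \<Rightarrow> ipoly" where
  "complete_hom k m = (\<Sum>c | length c = k \<and> sorted c \<and> set c \<subseteq> {0..m}. x_seq c)"

text \<open>
  An element of the symmetric group on \<open>{1..n}\<close> is a function \<open>\<sigma>\<close> with \<open>\<sigma> permutes {1..n}\<close>; its
  group inverse is the function inverse \<open>inv_into UNIV \<sigma>\<close>.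
\<close>

definition perm_word :: "nat \<Rightarrow> (nat \<Rightarrow> nat) \<Rightarrow> nat list" where
  "perm_word n \<sigma> = map \<sigma> [1..<Suc n]"

definition descent_set :: "nat \<Rightarrow> (nat \<Rightarrow> nat) \<Rightarrow> nat set" where
  "descent_set n \<sigma> = {j \<in> {1..n - 1}. \<sigma> j > \<sigma> (j + 1)}"

definition invcode :: "nat \<Rightarrow> (nat \<Rightarrow> nat) \<Rightarrow> nat list" where
  "invcode n \<sigma> =
    map (\<lambda>i. card {\<sigma> j |j k. 1 \<le> j \<and> j < k \<and> k \<le> n \<and> \<sigma> k = i \<and> \<sigma> j > i}) [1..<Suc n]"

definition maj :: "nat list \<Rightarrow> nat" where
  "maj w = (\<Sum>j | 1 \<le> j \<and> j < length w \<and> w ! (j - 1) > w ! j. j)"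

definition erase_below :: "nat \<Rightarrow> nat list \<Rightarrow> nat list" where
  "erase_below i w = filter (\<lambda>a. i \<le> a) w"

text \<open>
  The subtraction in \<open>majcode\<close> is on natural numbers; by \<open>maj_erase_below_mono\<close> below it never
  truncates.
\<close>

definition majcode :: "nat \<Rightarrow> (nat \<Rightarrow> nat) \<Rightarrow> nat list" where
  "majcode n \<sigma> =
    map (\<lambda>i. maj (erase_below i (perm_word n \<sigma>)) - maj (erase_below (i + 1) (perm_word n \<sigma>))) [1..<n]
    @ [0]"

lemma maj_remove_min:
  assumes "\<And>a. a \<in> set u \<union> set v \<Longrightarrow> x < a"
  shows "maj (u @ v) \<le> maj (u @ x # v)"
proof -
  define D where "D w = {j. 1 \<le> j \<and> j < length w \<and> w ! (j - 1) > w ! j}" for w :: "nat list"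
  define f where "f j = (if j \<le> length u then j else j + 1)" for j
  have fin: "finite (D w)" for w
    by (rule finite_subset[of _ "{..<length w}"]) (auto simp: D_def)
  have "f j \<in> D (u @ x # v)" if "j \<in> D (u @ v)" for j
  proof -
    consider "j < length u" | "j = length u" | k where "j = Suc (length u + k)"
      by (metis less_iff_Suc_add linorder_neqE_nat)
    then show ?thesis
    proof cases
      case 1
      with that show ?thesis by (auto simp: D_def f_def nth_append)
    next
      case 2
      with that have "u ! (length u - 1) \<in> set u" by (auto simp: D_def)
      with 2 that assms show ?thesis by (auto simp: D_def f_def nth_append)
    next
      case 3
      with that show ?thesis by (auto simp: D_def f_def nth_append)
    qed
  qed
  then have sub: "f ` D (u @ v) \<subseteq> D (u @ x # v)" by blast
  have inj: "inj_on f (D (u @ v))" by (auto simp: inj_on_def f_def split: if_splits)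
  have "maj (u @ v) = (\<Sum>j\<in>D (u @ v). j)" by (simp add: maj_def D_def)
  also have "\<dots> \<le> (\<Sum>j\<in>D (u @ v). f j)" by (rule sum_mono) (simp add: f_def)
  also have "\<dots> = (\<Sum>j\<in>f ` D (u @ v). j)" using inj by (simp add: sum.reindex)
  also have "\<dots> \<le> (\<Sum>j\<in>D (u @ x # v). j)" by (rule sum_mono2[OF fin sub]) simp
  also have "\<dots> = maj (u @ x # v)" by (simp add: maj_def D_def)
  finally show ?thesis .
qed

lemma maj_erase_below_mono:
  assumes "\<sigma> permutes {1..n}"
  shows "maj (erase_below (i + 1) (perm_word n \<sigma>)) \<le> maj (erase_below i (perm_word n \<sigma>))"
proof -
  let ?w = "perm_word n \<sigma>"
  have dist: "distinct ?w"
    unfolding perm_word_def using permutes_inj[OF assms]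
    by (simp add: distinct_map inj_on_subset)
  show ?thesis
  proof (cases "i \<in> set ?w")
    case True
    then obtain a b where w: "?w = a @ i # b" by (meson split_list)
    with dist have "i \<notin> set a" "i \<notin> set b" by auto
    then have "filter ((\<le>) (Suc i)) a = filter ((\<le>) i) a" "filter ((\<le>) (Suc i)) b = filter ((\<le>) i) b"
      by (auto intro!: filter_cong simp: Suc_le_eq le_less)
    moreover have "maj (filter ((\<le>) (Suc i)) a @ filter ((\<le>) (Suc i)) b)
        \<le> maj (filter ((\<le>) (Suc i)) a @ i # filter ((\<le>) (Suc i)) b)"
      by (rule maj_remove_min) auto
    ultimately show ?thesis by (simp add: erase_below_def w)
  next
    case False
    then have "filter ((\<le>) (Suc i)) ?w = filter ((\<le>) i) ?w"
      by (intro filter_cong refl) (auto simp: Suc_le_eq le_less)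
    then show ?thesis by (simp add: erase_below_def)
  qed
qed

definition is_composition :: "nat list \<Rightarrow> nat \<Rightarrow> bool" where
  "is_composition I n \<longleftrightarrow> (\<forall>i \<in> set I. 1 \<le> i) \<and> sum_list I = n"

text \<open>\<open>part_sum I q\<close> is the partial sum \<open>s\<^sub>q\<close> of the first \<open>q\<close> parts.\<close>

definition part_sum :: "nat list \<Rightarrow> nat \<Rightarrow> nat" where
  "part_sum I q = (\<Sum>k<q. I ! k)"

definition descent_class :: "nat \<Rightarrow> nat list \<Rightarrow> (nat \<Rightarrow> nat) set" where
  "descent_class n I =
    {\<sigma>. \<sigma> permutes {1..n} \<and> descent_set n \<sigma> = part_sum I ` {1..length I - 1}}"

text \<open>
  Rows and columns are indexed from \<open>0\<close>, so the column with index \<open>q\<close> carries the flag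
  \<open>n - s\<^bsub>q+1\<^esub>\<close>.
\<close>

definition flagged_ribbon :: "nat \<Rightarrow> nat list \<Rightarrow> ipoly" where
  "flagged_ribbon n I = det (mat (length I) (length I) (\<lambda>(p, q).
    if p \<le> q then complete_hom (\<Sum>k=p..q. I ! k) (n - part_sum I (q + 1))
    else if p = q + 1 then 1
    else 0))"

end

theory Submission
  imports Defs
begin

text \<open>
  Build \<open>\<sigma>\<^sup>-\<^sup>1\<close> by inserting the letters \<open>n, n - 1, \<dots>, 1\<close>. The position at which \<open>i\<close> is inserted is
  the entry \<open>a\<^sub>i\<close> of the inversion code, and \<open>i\<close> is a descent of \<open>\<sigma>\<close> iff \<open>a\<^sub>i > a\<^sub>i\<^sub>+\<^sub>1\<close>. The entry of
  the majcode is a label of the same position, and two facts about labels suffice: they are a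
  bijection from positions to \<open>{0..m}\<close>, and after an insertion at position \<open>p\<close> the set of labels of
  the positions \<open>0, \<dots>, p\<close> is what it was before. With
  \<open>h\<^sub>k\<^sub>+\<^sub>1(e\<^sub>0, \<dots>, e\<^sub>p) = \<Sum>b\<le>p. e\<^sub>b h\<^sub>k(e\<^sub>0, \<dots>, e\<^sub>b)\<close> they show that the insertions of a block of \<open>k\<close>
  letters without descents contribute a factor \<open>h\<^sub>k(X\<^sub>m)\<close>, whatever the word of length \<open>m\<close> they are
  inserted into. Hence both sums satisfy
  \<open>R(i, j, J) + R(i + j, J) = h\<^sub>i(X\<^sub>m) R(j, J)\<close> with \<open>m\<close> the sum of the parts of \<open>(j, J)\<close>, which is the
  Laplace expansion of the determinant along its first column.
\<close>

section \<open>Complete homogeneous polynomials on a finite set of variables\<close>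

text \<open>The labels of an initial segment of positions can be any finite set of indices, hence an
  alphabet more general than \<open>{..m}\<close>; multisets stand for monomials.\<close>

definition hom_on :: "nat \<Rightarrow> nat set \<Rightarrow> ipoly" where
  "hom_on k L = (\<Sum>M | size M = k \<and> set_mset M \<subseteq> L. prod_mset (image_mset indet M))"

lemma x_seq_eq_prod_mset: "x_seq c = prod_mset (image_mset indet (mset c))"
  by (induction c) (auto simp: x_seq_def)

lemma finite_msets_of_size:
  assumes "finite L"
  shows "finite {M. size M = k \<and> set_mset M \<subseteq> L}"
proof -
  have "{M. size M = k \<and> set_mset M \<subseteq> L} \<subseteq> mset ` {xs. set xs \<subseteq> L \<and> length xs = k}"
  proof
    fix M assume M: "M \<in> {M. size M = k \<and> set_mset M \<subseteq> L}"
    obtain xs where "mset xs = M" by (metis ex_mset)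
    with M show "M \<in> mset ` {xs. set xs \<subseteq> L \<and> length xs = k}"
      by (intro image_eqI[of _ _ xs]) auto
  qed
  then show ?thesis by (rule finite_subset) (simp add: finite_lists_length_eq assms)
qed

lemma complete_hom_eq_hom_on: "complete_hom k m = hom_on k {..m}"
  unfolding complete_hom_def hom_on_def
proof (rule sum.reindex_bij_witness[where i = sorted_list_of_multiset and j = mset])
  fix c :: "nat list" assume "c \<in> {c. length c = k \<and> sorted c \<and> set c \<subseteq> {0..m}}"
  then show "sorted_list_of_multiset (mset c) = c" by (simp add: sorted_sort_id)
qed (auto simp: x_seq_eq_prod_mset size_mset[symmetric] simp del: size_mset)

lemma hom_on_0: "hom_on 0 L = 1"
proof -
  have "{M. size M = 0 \<and> set_mset M \<subseteq> L} = {{#}}" by auto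
  then show ?thesis by (simp add: hom_on_def)
qed

lemma hom_on_Suc_empty: "hom_on (Suc k) {} = 0"
proof -
  have "{M :: nat multiset. size M = Suc k \<and> set_mset M \<subseteq> {}} = {}" by auto
  then show ?thesis by (simp add: hom_on_def)
qed

lemma hom_on_insert:
  assumes "finite L" "e \<notin> L"
  shows "hom_on (Suc k) (insert e L) = hom_on (Suc k) L + indet e * hom_on k (insert e L)"
proof -
  let ?S = "\<lambda>k L. {M. size M = k \<and> set_mset M \<subseteq> L}"
  let ?p = "\<lambda>M. prod_mset (image_mset indet M)"
  have split: "?S (Suc k) (insert e L) = ?S (Suc k) L \<union> add_mset e ` ?S k (insert e L)"
  proof (intro equalityI subsetI)
    fix M assume M: "M \<in> ?S (Suc k) (insert e L)"
    show "M \<in> ?S (Suc k) L \<union> add_mset e ` ?S k (insert e L)"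
    proof (cases "e \<in># M")
      case True
      then obtain N where "M = add_mset e N" by (metis multi_member_split)
      with M show ?thesis by auto
    next
      case False
      with M show ?thesis by auto
    qed
  qed auto
  have "hom_on (Suc k) (insert e L) = sum ?p (?S (Suc k) L) + sum ?p (add_mset e ` ?S k (insert e L))"
    unfolding hom_on_def split using assms
    by (intro sum.union_disjoint finite_imageI finite_msets_of_size) auto
  also have "sum ?p (add_mset e ` ?S k (insert e L)) = indet e * hom_on k (insert e L)"
    unfolding hom_on_def by (subst sum.reindex) (auto simp: inj_on_def sum_distrib_left)
  finally show ?thesis by (simp add: hom_on_def)
qed

text \<open>Classify the monomials by the largest \<open>b\<close> for which \<open>f b\<close>
  occurs and cancel one such factor. The induction adds one variable at a time.\<close>

lemma hom_on_Suc_image: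
  fixes f :: "nat \<Rightarrow> nat"
  assumes "inj_on f {..p}"
  shows "hom_on (Suc k) (f ` {..p}) = (\<Sum>b\<le>p. indet (f b) * hom_on k (f ` {..b}))"
  using assms
proof (induction p)
  case 0
  show ?case using hom_on_insert[of "{}" "f 0" k] by (simp add: hom_on_Suc_empty)
next
  case (Suc p)
  have "inj_on f {..p}" using Suc.prems by (rule inj_on_subset) auto
  moreover have "f (Suc p) \<notin> f ` {..p}"
    using Suc.prems by (fastforce simp: inj_on_def)
  moreover have "f ` {..Suc p} = insert (f (Suc p)) (f ` {..p})"
    by (auto simp: atMost_Suc)
  ultimately show ?case using Suc.IH by (simp add: hom_on_insert add.commute)
qed

section \<open>Subexcedant codes and their relabellings\<close>

text \<open>The head belongs to the letter inserted last, so its bound is the number of letters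
  already present, and list induction follows the insertion process.\<close>

fun subexcedant :: "nat list \<Rightarrow> bool" where
  "subexcedant [] \<longleftrightarrow> True"
| "subexcedant (a # c) \<longleftrightarrow> a \<le> length c \<and> subexcedant c"

text \<open>The tail passed to \<open>f\<close> encodes the word present just before the insertion
  that is being labelled.\<close>

fun relabel :: "(nat list \<Rightarrow> nat \<Rightarrow> nat) \<Rightarrow> nat list \<Rightarrow> nat list" where
  "relabel f [] = []"
| "relabel f (a # c) = f c a # relabel f c"

definition descents :: "nat list \<Rightarrow> nat set" where
  "descents w = {j. 1 \<le> j \<and> j < length w \<and> w ! (j - 1) > w ! j}"

definition code_class :: "nat list \<Rightarrow> nat list set" where
  "code_class I = {c. subexcedant c \<and> length c = sum_list I \<and>
     descents c = part_sum I ` {1..length I - 1}}"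

lemma length_relabel [simp]: "length (relabel f c) = length c"
  by (induction c) auto

lemma nth_relabel: "i < length c \<Longrightarrow> relabel f c ! i = f (drop (Suc i) c) (c ! i)"
  by (induction c arbitrary: i) (auto simp: nth_Cons split: nat.split)

lemma relabel_id: "relabel (\<lambda>_ a. a) c = c"
  by (induction c) auto

lemma subexcedant_append: "subexcedant (b @ c) \<Longrightarrow> subexcedant c"
  by (induction b) auto

lemma subexcedant_nth: "subexcedant c \<longleftrightarrow> (\<forall>i<length c. c ! i < length c - i)"
proof (induction c)
  case (Cons a c)
  then show ?case by (auto simp: nth_Cons less_Suc_eq_le split: nat.splits)
qed simp

text \<open>The last entry of \<open>b\<close> is bounded by \<open>length c\<close>, and sortedness
  passes this bound to the other entries, whose own bounds are weaker.\<close>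

lemma subexcedant_sorted_append:
  assumes "sorted b" "b \<noteq> []"
  shows "subexcedant (b @ c) \<longleftrightarrow> subexcedant c \<and> set b \<subseteq> {..length c}"
  using assms
proof (induction b)
  case (Cons x b)
  show ?case
  proof (cases "b = []")
    case False
    then have "x \<le> hd b" "hd b \<in> set b" using Cons.prems by auto
    then have "x \<le> length c" if "set b \<subseteq> {..length c}" using that by fastforce
    then show ?thesis using Cons False by auto
  qed auto
qed simp

section \<open>Descents of concatenated codes and cuts of compositions\<close>

lemma descents_empty_iff_sorted: "descents w = {} \<longleftrightarrow> sorted w"
proof
  assume "descents w = {}"
  then have "w ! i \<le> w ! Suc i" if "Suc i < length w" for i
    using that by (auto simp: descents_def not_less dest!: spec[of _ "Suc i"])
  then show "sorted w" by (simp add: sorted_iff_nth_Suc)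
next
  assume "sorted w"
  then have "\<not> w ! j < w ! (j - 1)" if "j < length w" for j
    using that by (simp add: sorted_nth_mono not_less)
  then show "descents w = {}" by (auto simp: descents_def)
qed

text \<open>The junction \<open>length b\<close> is left out because a descent there depends on both
  factors; every other position sees only one of them.\<close>

lemma descents_append:
  assumes "b \<noteq> []"
  shows "descents (b @ c) - {length b} = descents b \<union> (+) (length b) ` descents c"
proof (rule Set.set_eqI)
  fix j
  consider "j < length b" | "j = length b" | k where "j = length b + Suc k"
    by (metis less_iff_Suc_add linorder_neqE_nat add_Suc_right)
  then show "j \<in> descents (b @ c) - {length b} \<longleftrightarrow> j \<in> descents b \<union> (+) (length b) ` descents c"
  proof cases
    case 1
    then show ?thesis by (auto simp: descents_def nth_append)
  next
    case 2
    then show ?thesis by (auto simp: descents_def)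
  next
    case 3
    then show ?thesis by (auto simp: descents_def nth_append image_iff)
  qed
qed

lemma part_sum_Cons_Suc: "part_sum (i # J) (Suc q) = i + part_sum J q"
  by (simp add: part_sum_def sum.lessThan_Suc_shift del: sum.lessThan_Suc)

lemma part_sum_0 [simp]: "part_sum J 0 = 0"
  by (simp add: part_sum_def)

lemma part_sum_image_Suc:
  "part_sum (i # J) ` {Suc a..Suc b} = (+) i ` part_sum J ` {a..b}"
proof -
  have "{Suc a..Suc b} = Suc ` {a..b}" by (simp add: image_Suc_atLeastAtMost)
  then show ?thesis by (simp only: image_image part_sum_Cons_Suc)
qed

lemma part_sum_cuts_Cons:
  "part_sum (i # j # J) ` {1..length (i # j # J) - 1} =
    insert i ((+) i ` part_sum (j # J) ` {1..length (j # J) - 1})"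
proof -
  have "{0..length J} = insert 0 {1..length J}" by auto
  then show ?thesis using part_sum_image_Suc[of i "j # J" 0 "length J"] by simp
qed

lemma part_sum_cuts_merge:
  "part_sum ((i + j) # J) ` {1..length ((i + j) # J) - 1} =
    (+) i ` part_sum (j # J) ` {1..length (j # J) - 1}"
proof (cases J)
  case (Cons k K)
  show ?thesis
    using part_sum_image_Suc[of "i + j" J 0 "length K"] part_sum_image_Suc[of j J 0 "length K"]
    by (simp add: Cons image_image add.assoc)
qed simp

lemma finite_subexcedant: "finite {c. subexcedant c \<and> length c = n}"
proof (rule finite_subset)
  show "{c. subexcedant c \<and> length c = n} \<subseteq> {c. set c \<subseteq> {..n} \<and> length c = n}"
    by (auto simp: subexcedant_nth in_set_conv_nth) (metis diff_le_self le_trans less_imp_le)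
qed (simp add: finite_lists_length_eq)

lemma finite_code_class: "finite (code_class I)"
  by (rule finite_subset[OF _ finite_subexcedant[of "sum_list I"]]) (auto simp: code_class_def)

text \<open>Both compositions forbid descents inside the first \<open>i\<close> entries and
  prescribe the same descents after them. They differ only at the junction, so in the union prefix
  and tail vary independently.\<close>

lemma code_class_split:
  assumes "1 \<le> i" "1 \<le> j"
  shows "code_class (i # j # J) \<union> code_class ((i + j) # J) =
      (\<lambda>(b, c). b @ c) ` ({b. length b = i \<and> sorted b \<and> set b \<subseteq> {..sum_list (j # J)}} \<times> code_class (j # J))"
    and "code_class (i # j # J) \<inter> code_class ((i + j) # J) = {}"
proof -
  let ?S = "part_sum (j # J) ` {1..length (j # J) - 1}"
  have "part_sum (j # J) q \<noteq> 0" if "q \<ge> 1" for q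
    using that assms by (cases q) (auto simp: part_sum_Cons_Suc)
  \<comment> \<open>Since \<open>j\<close> is positive, 0 is not a cut of \<open>j # J\<close>;
    hence \<open>i\<close> is not a shifted cut, and a descent at \<open>i\<close> tells the two
    classes apart.\<close>
  then have S0: "0 \<notin> ?S" by force
  then have iS: "i \<notin> (+) i ` ?S" by auto
  show "code_class (i # j # J) \<inter> code_class ((i + j) # J) = {}"
    unfolding code_class_def part_sum_cuts_Cons part_sum_cuts_merge using iS by blast
  have des: "descents (b @ c) = insert i ((+) i ` ?S) \<or> descents (b @ c) = (+) i ` ?S \<longleftrightarrow>
      sorted b \<and> descents c = ?S" if "length b = i" for b c
  proof -
    have "b \<noteq> []" using that assms by auto
    have "descents (b @ c) = insert i ((+) i ` ?S) \<or> descents (b @ c) = (+) i ` ?S \<longleftrightarrow>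
        descents (b @ c) - {i} = (+) i ` ?S" using iS by auto
    also have "\<dots> \<longleftrightarrow> descents b \<union> (+) i ` descents c = (+) i ` ?S"
      using descents_append[OF \<open>b \<noteq> []\<close>, of c] that by simp
    also have "\<dots> \<longleftrightarrow> descents b = {} \<and> (+) i ` descents c = (+) i ` ?S"
    proof -
      \<comment> \<open>Descents inside \<open>b\<close> lie below \<open>i\<close> and shifted cuts
        do not, so a union equal to the shifted cuts leaves no descent in \<open>b\<close>.\<close>
      have "x < i" if "x \<in> descents b" for x using that \<open>length b = i\<close> by (auto simp: descents_def)
      then have "descents b \<inter> (+) i ` ?S = {}" by fastforce
      then show ?thesis by blast
    qed
    also have "\<dots> \<longleftrightarrow> sorted b \<and> descents c = ?S"
      by (simp add: descents_empty_iff_sorted inj_image_eq_iff)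
    finally show ?thesis .
  qed
  have key: "subexcedant (b @ c) \<and>
      (descents (b @ c) = insert i ((+) i ` ?S) \<or> descents (b @ c) = (+) i ` ?S) \<longleftrightarrow>
      subexcedant c \<and> set b \<subseteq> {..length c} \<and> sorted b \<and> descents c = ?S" if "length b = i" for b c
  proof -
    have "b \<noteq> []" using that assms by auto
    then show ?thesis unfolding des[OF that] by (cases "sorted b") (simp_all add: subexcedant_sorted_append)
  qed
  let ?P = "{b. length b = i \<and> sorted b \<and> set b \<subseteq> {..sum_list (j # J)}}"
  show "code_class (i # j # J) \<union> code_class ((i + j) # J) =
      (\<lambda>(b, c). b @ c) ` ({b. length b = i \<and> sorted b \<and> set b \<subseteq> {..sum_list (j # J)}} \<times> code_class (j # J))"
    (is "?A = ?B")
  proof (rule Set.set_eqI)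
    fix d
    have "d \<in> ?A \<longleftrightarrow> subexcedant d \<and> length d = i + sum_list (j # J) \<and>
        (descents d = insert i ((+) i ` ?S) \<or> descents d = (+) i ` ?S)"
      unfolding code_class_def part_sum_cuts_Cons part_sum_cuts_merge by auto
    also have "\<dots> \<longleftrightarrow> (\<exists>b c. d = b @ c \<and> length b = i \<and> length c = sum_list (j # J) \<and> subexcedant (b @ c) \<and>
        (descents (b @ c) = insert i ((+) i ` ?S) \<or> descents (b @ c) = (+) i ` ?S))"
    proof (intro iffI, goal_cases)
      case 1
      then show ?case by (intro exI[of _ "take i d"] exI[of _ "drop i d"]) simp
    next
      case 2
      then show ?case by (elim exE conjE) simp
    qed
    also have "\<dots> \<longleftrightarrow> (\<exists>b c. d = b @ c \<and> length b = i \<and> length c = sum_list (j # J) \<and> subexcedant c \<and>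
        set b \<subseteq> {..length c} \<and> sorted b \<and> descents c = ?S)"
      by (intro ex_cong1 conj_cong refl key)
    also have "\<dots> \<longleftrightarrow> d \<in> ?B"
    proof (intro iffI, goal_cases)
      case 1
      then obtain b c where "d = b @ c" "b \<in> ?P" "c \<in> code_class (j # J)"
        unfolding code_class_def by auto
      then show ?case by auto
    next
      case 2
      then obtain b c where "d = b @ c" "b \<in> ?P" "c \<in> code_class (j # J)" by auto
      then show ?case unfolding code_class_def by (intro exI[of _ b] exI[of _ c]) simp
    qed
    finally show "d \<in> ?A \<longleftrightarrow> d \<in> ?B" .
  qed
qed

lemma code_class_single:
  "code_class [i] = {b. length b = i \<and> sorted b \<and> set b \<subseteq> {..0}}"
proof -
  have "subexcedant b \<longleftrightarrow> set b \<subseteq> {..0}" if "sorted b" for b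
    using subexcedant_sorted_append[OF that, of "[]"] by (cases "b = []") auto
  then show ?thesis by (auto simp: code_class_def descents_empty_iff_sorted)
qed

section \<open>The recursion for flagged ribbon functions\<close>

lemma flagged_ribbon_single: "flagged_ribbon i [i] = complete_hom i 0"
  by (simp add: flagged_ribbon_def det_single part_sum_def)

text \<open>Only the top two entries of the first column are nonzero. Deleting row 0 leaves the
  matrix of \<open>j # J\<close>, deleting row 1 that of \<open>(i + j) # J\<close>.\<close>

lemma flagged_ribbon_rec:
  "flagged_ribbon (sum_list (i # j # J)) (i # j # J) =
     complete_hom i (sum_list (j # J)) * flagged_ribbon (sum_list (j # J)) (j # J)
     - flagged_ribbon (sum_list ((i + j) # J)) ((i + j) # J)"
proof -
  let ?n = "sum_list (i # j # J)" and ?r = "Suc (Suc (length J))"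
  define e where "e n I = (\<lambda>(p, q). if p \<le> q then complete_hom (\<Sum>k=p..q. I ! k) (n - part_sum I (q + 1))
    else if p = q + 1 then 1 else (0 :: ipoly))" for n I
  have R: "flagged_ribbon n I = det (mat (length I) (length I) (e n I))" for n I
    by (simp add: flagged_ribbon_def e_def)
  let ?M = "mat ?r ?r (e ?n (i # j # J))"
  have shift: "(\<Sum>k=Suc p..Suc q. (x # I) ! k) = (\<Sum>k=p..q. I ! k)" for p q x and I :: "nat list"
    unfolding sum.shift_bounds_cl_Suc_ivl by simp
  have head: "(\<Sum>k=0..Suc q. (x # I) ! k) = x + (\<Sum>k=0..q. I ! k)" for q x and I :: "nat list"
    by (simp add: sum.atLeast0_atMost_Suc_shift del: sum.cl_ivl_Suc)
  \<comment> \<open>Removing the first part lowers the total and the partial sums alike by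
    \<open>x\<close>, which preserves the flag.\<close>
  have e_Cons: "e n (x # I) (Suc p, Suc q) = e (n - x) I (p, q)" for n x p q and I :: "nat list"
    unfolding e_def prod.case shift Suc_eq_plus1[symmetric] part_sum_Cons_Suc Suc_le_mono
      nat.inject diff_diff_left by (rule refl)
  have del0: "mat_delete ?M 0 0 = mat (length (j # J)) (length (j # J)) (e (sum_list (j # J)) (j # J))"
    by (rule eq_matI) (auto simp: mat_delete_def e_Cons)
  have del1: "mat_delete ?M 1 0 =
      mat (length ((i + j) # J)) (length ((i + j) # J)) (e (sum_list ((i + j) # J)) ((i + j) # J))"
  proof (rule eq_matI)
    fix p q assume "p < dim_row (mat (length ((i + j) # J)) (length ((i + j) # J)) (e (sum_list ((i + j) # J)) ((i + j) # J)))"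
      "q < dim_col (mat (length ((i + j) # J)) (length ((i + j) # J)) (e (sum_list ((i + j) # J)) ((i + j) # J)))"
    then have pq: "p < Suc (length J)" "q < Suc (length J)" by auto
    have "e ?n (i # j # J) (if p < 1 then p else Suc p, Suc q) = e (sum_list ((i + j) # J)) ((i + j) # J) (p, q)"
    proof (cases p)
      \<comment> \<open>In row 0 the sums start at \<open>i\<close>; without column 0 each of them
        contains \<open>i + j\<close>, the first part of the merged composition.\<close>
      case 0
      have "(\<Sum>k=0..Suc q. (i # j # J) ! k) = (\<Sum>k=0..q. ((i + j) # J) ! k)"
        unfolding head by (cases q) (simp_all only: head, simp_all)
      moreover have "part_sum (i # j # J) (Suc (Suc q)) = part_sum ((i + j) # J) (Suc q)"
        by (simp add: part_sum_Cons_Suc)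
      ultimately show ?thesis using 0 by (simp add: e_def add.assoc del: sum.cl_ivl_Suc)
    next
      case (Suc p')
      then show ?thesis
        by (cases q) (simp_all add: e_Cons, simp_all add: e_def)
    qed
    then show "mat_delete ?M 1 0 $$ (p, q) = mat (length ((i + j) # J)) (length ((i + j) # J))
       (e (sum_list ((i + j) # J)) ((i + j) # J)) $$ (p, q)"
      using pq by (simp add: mat_delete_def)
  qed (auto simp: mat_delete_def)
  have "det ?M = (\<Sum>p<?r. ?M $$ (p, 0) * cofactor ?M p 0)"
    by (rule laplace_expansion_column) auto
  also have "\<dots> = (\<Sum>p\<in>{0, 1}. ?M $$ (p, 0) * cofactor ?M p 0)"
    by (rule sum.mono_neutral_right) (auto simp: e_def)
  also have "\<dots> = complete_hom i (sum_list (j # J)) * det (mat_delete ?M 0 0) - det (mat_delete ?M 1 0)"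
    by (simp add: e_def cofactor_def part_sum_Cons_Suc)
  finally show ?thesis unfolding R del0 del1 by simp
qed

section \<open>Generating functions of relabelled codes\<close>

text \<open>Abstracts from the two codes, so that one computation yields both sums: the inversion
  code uses the identity, the majcode the labels \<open>maj_label\<close>.\<close>

locale relabelling =
  fixes f :: "nat list \<Rightarrow> nat \<Rightarrow> nat"
  assumes bij: "subexcedant c \<Longrightarrow> bij_betw (f c) {..length c} {..length c}"
    and image_Cons: "subexcedant (a # c) \<Longrightarrow> f (a # c) ` {..a} = f c ` {..a}"
begin

text \<open>The last entry of \<open>b\<close> is inserted first and bounds the others by
  sortedness. Hence the induction peels entries off the end of \<open>b\<close>, with both
  \<open>c\<close> and the bound \<open>p\<close> varying.\<close>

lemma sum_sorted_prefixes:
  assumes "subexcedant c" "p \<le> length c"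
  shows "(\<Sum>b | length b = k \<and> sorted b \<and> set b \<subseteq> {..p}. x_seq (relabel f (b @ c))) =
    hom_on k (f c ` {..p}) * x_seq (relabel f c)"
  using assms
proof (induction k arbitrary: c p)
  case 0
  have "{b :: nat list. length b = 0 \<and> sorted b \<and> set b \<subseteq> {..p}} = {[]}" by auto
  then show ?case by (simp add: hom_on_0)
next
  case (Suc k)
  let ?A = "\<lambda>k p. {b :: nat list. length b = k \<and> sorted b \<and> set b \<subseteq> {..p}}"
  have fin: "finite (?A k p)" for k p
    by (rule finite_subset[OF _ finite_lists_length_eq[of "{..p}" k]]) auto
  have "(\<Sum>b\<in>?A (Suc k) p. x_seq (relabel f (b @ c))) =
      (\<Sum>(x, b)\<in>Sigma {..p} (?A k). x_seq (relabel f (b @ x # c)))"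
    by (rule sum.reindex_bij_witness[where i = "\<lambda>(x, b). b @ [x]" and j = "\<lambda>b. (last b, butlast b)"])
      (auto simp: sorted_append length_Suc_conv_rev)
  also have "\<dots> = (\<Sum>x\<le>p. \<Sum>b\<in>?A k x. x_seq (relabel f (b @ x # c)))"
    using fin by (simp add: sum.Sigma)
  also have "\<dots> = (\<Sum>x\<le>p. indet (f c x) * hom_on k (f c ` {..x}) * x_seq (relabel f c))"
  proof (rule sum.cong)
    fix x assume "x \<in> {..p}"
    then have s: "subexcedant (x # c)" using Suc.prems by auto
    have "(\<Sum>b\<in>?A k x. x_seq (relabel f (b @ x # c))) =
        hom_on k (f (x # c) ` {..x}) * x_seq (relabel f (x # c))"
      using s by (intro Suc.IH) auto
    \<comment> \<open>\<open>image_Cons\<close> trades the labels after the insertion of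
      \<open>x\<close> for those before it, which gives the summands of
      \<open>hom_on_Suc_image\<close>.\<close>
    then show "(\<Sum>b\<in>?A k x. x_seq (relabel f (b @ x # c))) =
        indet (f c x) * hom_on k (f c ` {..x}) * x_seq (relabel f c)"
      unfolding image_Cons[OF s] by (simp add: x_seq_def mult_ac)
  qed simp
  also have "\<dots> = hom_on (Suc k) (f c ` {..p}) * x_seq (relabel f c)"
  proof -
    have "inj_on (f c) {..p}"
      using bij[OF Suc.prems(1)] Suc.prems(2) by (auto simp: bij_betw_def intro: inj_on_subset)
    then show ?thesis by (simp add: hom_on_Suc_image sum_distrib_right)
  qed
  finally show ?case .
qed

text \<open>For \<open>p = length c\<close> the labels exhaust \<open>{..length c}\<close>, so the
  factor depends on \<open>c\<close> only through its length.\<close>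

lemma sum_full_prefixes:
  assumes "subexcedant c"
  shows "(\<Sum>b | length b = k \<and> sorted b \<and> set b \<subseteq> {..length c}. x_seq (relabel f (b @ c))) =
    complete_hom k (length c) * x_seq (relabel f c)"
  using sum_sorted_prefixes[OF assms order_refl, of k] bij[OF assms]
  by (simp add: complete_hom_eq_hom_on bij_betw_def)

text \<open>Induction on the length works because dropping the first part and merging the first two
  parts both shorten the composition.\<close>

theorem sum_code_class:
  assumes "I \<noteq> []" "\<forall>i\<in>set I. 1 \<le> i"
  shows "(\<Sum>c\<in>code_class I. x_seq (relabel f c)) = flagged_ribbon (sum_list I) I"
  using assms
proof (induction I rule: length_induct)
  case (1 I)
  let ?G = "\<lambda>I. \<Sum>c\<in>code_class I. x_seq (relabel f c)"
  obtain i K where I: "I = i # K" using "1.prems" by (cases I) auto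
  have IH: "?G L = flagged_ribbon (sum_list L) L"
    if "length L < length I" "L \<noteq> []" "\<forall>i\<in>set L. 1 \<le> i" for L
    using "1.IH" that by blast
  show ?case
  proof (cases K)
    case Nil
    then show ?thesis
      using sum_full_prefixes[of "[]" i]
      by (simp add: I code_class_single flagged_ribbon_single x_seq_def)
  next
    case (Cons j J)
    have pos: "1 \<le> i" "1 \<le> j" using "1.prems" by (auto simp: I Cons)
    let ?B = "{b. length b = i \<and> sorted b \<and> set b \<subseteq> {..sum_list (j # J)}}"
    have "?G I + ?G ((i + j) # J) = (\<Sum>c\<in>code_class I \<union> code_class ((i + j) # J). x_seq (relabel f c))"
      using code_class_split(2)[OF pos] by (simp add: sum.union_disjoint finite_code_class I Cons)
    also have "\<dots> = (\<Sum>(b, c)\<in>?B \<times> code_class (j # J). x_seq (relabel f (b @ c)))"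
      unfolding I Cons code_class_split(1)[OF pos]
      by (subst sum.reindex) (auto simp: inj_on_def case_prod_unfold)
    also have "\<dots> = (\<Sum>c\<in>code_class (j # J). \<Sum>b\<in>?B. x_seq (relabel f (b @ c)))"
      unfolding sum.cartesian_product[symmetric] by (rule sum.swap)
    also have "\<dots> = (\<Sum>c\<in>code_class (j # J). complete_hom i (sum_list (j # J)) * x_seq (relabel f c))"
    proof (rule sum.cong)
      fix c assume "c \<in> code_class (j # J)"
      then have "subexcedant c" "length c = sum_list (j # J)" by (auto simp: code_class_def)
      then show "(\<Sum>b\<in>?B. x_seq (relabel f (b @ c))) =
          complete_hom i (sum_list (j # J)) * x_seq (relabel f c)"
        using sum_full_prefixes[of c i] by simp
    qed simp
    also have "\<dots> = complete_hom i (sum_list (j # J)) * flagged_ribbon (sum_list (j # J)) (j # J)"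
      using IH[of "j # J"] "1.prems" by (simp add: sum_distrib_left[symmetric] I Cons)
    finally have "?G I + flagged_ribbon (sum_list ((i + j) # J)) ((i + j) # J) =
        complete_hom i (sum_list (j # J)) * flagged_ribbon (sum_list (j # J)) (j # J)"
      using IH[of "(i + j) # J"] "1.prems" by (simp add: I Cons)
    then show ?thesis unfolding I Cons flagged_ribbon_rec by (simp add: eq_diff_eq)
  qed
qed

end

section \<open>Major index labels of insertion positions\<close>

text \<open>The growth of the major index when a new minimum is inserted at position
  \<open>p\<close>: each descent beyond \<open>p\<close> moves by one, and \<open>p\<close> becomes
  a descent unless it was one.\<close>

definition maj_label :: "nat set \<Rightarrow> nat \<Rightarrow> nat" where
  "maj_label E p = card {j \<in> E. p < j} + (if p \<in> E then 0 else p)"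

text \<open>A new minimum at position \<open>p\<close> causes a descent just before it and none just
  after, so an old descent at \<open>p\<close> stays and only those beyond \<open>p\<close>
  shift.\<close>

definition insert_descents :: "nat \<Rightarrow> nat set \<Rightarrow> nat set" where
  "insert_descents p E = insert p ({j \<in> E. j < p} \<union> Suc ` {j \<in> E. p < j})"

text \<open>
  Adding \<open>0\<close> to the descent set makes insertion in front behave like insertion into a descent.
\<close>

lemma descents_insert_min:
  assumes "\<And>a. a \<in> set u \<union> set v \<Longrightarrow> x < a"
  shows "insert 0 (descents (u @ x # v)) = insert_descents (length u) (insert 0 (descents (u @ v)))"
proof (rule Set.set_eqI)
  fix j
  let ?p = "length u"
  consider "j < ?p" | "j = ?p" | "j = Suc ?p" | k where "j = Suc (Suc (?p + k))"
    by (metis less_iff_Suc_add linorder_neqE_nat add_Suc_right add_0_right not0_implies_Suc)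
  then show "j \<in> insert 0 (descents (u @ x # v)) \<longleftrightarrow>
      j \<in> insert_descents ?p (insert 0 (descents (u @ v)))"
  proof cases
    case 1
    then show ?thesis by (auto simp: descents_def insert_descents_def nth_append)
  next
    case 2
    have "x < u ! (?p - Suc 0)" if "u \<noteq> []" using that assms by simp
    then show ?thesis using 2 by (cases "u = []") (auto simp: descents_def insert_descents_def nth_append Suc_le_eq)
  next
    case 3
    have "\<not> v ! 0 < x" if "v \<noteq> []" using that assms[of "v ! 0"] by simp
    then show ?thesis using 3
      by (cases "v = []") (auto simp: descents_def insert_descents_def nth_append)
  next
    case 4
    then show ?thesis by (auto simp: descents_def insert_descents_def nth_append image_iff)
  qed
qed

lemma sum_insert_descents:
  assumes "finite E"
  shows "\<Sum>(insert_descents p E) = \<Sum>E + maj_label E p"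
proof -
  let ?L = "{j \<in> E. j < p}" and ?R = "{j \<in> E. p < j}"
  have "\<Sum>(insert_descents p E) = p + (\<Sum>?L + \<Sum>(Suc ` ?R))"
    unfolding insert_descents_def using assms
    by (subst sum.insert, simp, force, subst sum.union_disjoint) auto
  moreover have "\<Sum>(Suc ` ?R) = \<Sum>?R + card ?R"
    by (subst sum.reindex) (auto simp: sum_Suc)
  moreover have "\<Sum>E = \<Sum>(?L \<union> ?R) + (if p \<in> E then p else 0)"
  proof -
    have "E - {p} = ?L \<union> ?R" by auto
    then show ?thesis using sum.remove[OF assms, of p "\<lambda>x. x"] by (cases "p \<in> E") auto
  qed
  moreover have "\<Sum>(?L \<union> ?R) = \<Sum>?L + \<Sum>?R"
    using assms by (intro sum.union_disjoint) auto
  ultimately show ?thesis by (simp add: maj_label_def)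
qed

lemma maj_insert_min:
  assumes "\<And>a. a \<in> set u \<union> set v \<Longrightarrow> x < a"
  shows "maj (u @ x # v) = maj (u @ v) + maj_label (insert 0 (descents (u @ v))) (length u)"
proof -
  have fin: "finite (descents w)" for w
    by (rule finite_subset[of _ "{..<length w}"]) (auto simp: descents_def)
  have "maj w = \<Sum>(insert 0 (descents w))" for w
    using fin[of w] by (simp add: sum.insert_if maj_def descents_def)
  then show ?thesis using descents_insert_min[OF assms] sum_insert_descents fin by simp
qed

lemma card_Collect_split:
  fixes E :: "nat set"
  assumes "finite E" "p \<le> q"
  shows "card {j \<in> E. p < j} = card {j \<in> E. p < j \<and> j \<le> q} + card {j \<in> E. q < j}"
proof -
  have "{j \<in> E. p < j} = {j \<in> E. p < j \<and> j \<le> q} \<union> {j \<in> E. q < j}" using assms by auto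
  then show ?thesis using assms by (simp add: card_Un_disjoint disjoint_iff)
qed

text \<open>
  Labels decrease along \<open>E\<close>, increase along its complement, and every label of the complement
  exceeds every label of \<open>E\<close>.
\<close>

lemma inj_maj_label:
  assumes "finite E"
  shows "inj (maj_label E)"
proof -
  have ne: "maj_label E p \<noteq> maj_label E q" if "p < q" for p q
  proof -
    let ?m = "{j \<in> E. p < j \<and> j \<le> q}"
    have split: "card {j \<in> E. p < j} = card ?m + card {j \<in> E. q < j}"
      using card_Collect_split[OF assms] that by simp
    have fin: "finite ?m" using assms by simp
    have le: "card ?m \<le> q - p"
      using card_mono[of "{p<..q}" ?m] by (simp add: subset_iff)
    show ?thesis
    proof (cases "q \<in> E")
      case True
      \<comment> \<open>Here \<open>q\<close> itself is counted in \<open>?m\<close>, so the label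
        at \<open>q\<close> is smaller than the one at \<open>p\<close>.\<close>
      then have "card ?m > 0" using fin that by (subst card_gt_0_iff) auto
      then show ?thesis using split True that by (auto simp: maj_label_def)
    next
      case False
      \<comment> \<open>Here \<open>q\<close> is not counted, so \<open>card ?m + p < q\<close> and
        the label at \<open>q\<close> is the larger one.\<close>
      then have "?m \<subseteq> {p<..<q}" by (auto simp: le_less)
      then have "card ?m \<le> q - Suc p"
        using card_mono[of "{p<..<q}" ?m] by auto
      then show ?thesis using split False that by (auto simp: maj_label_def)
    qed
  qed
  show ?thesis by (rule injI) (metis ne linorder_neqE_nat)
qed

text \<open>The labels of the \<open>p + 1\<close> positions are distinct and lie in an interval of
  \<open>p + 1\<close> numbers. This interval depends on \<open>E\<close> only through the number of
  elements beyond \<open>p\<close>.\<close>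

lemma maj_label_image:
  assumes "finite E"
  shows "maj_label E ` {..p} = {card {j \<in> E. p < j}..card {j \<in> E. p < j} + p}"
proof (rule card_subset_eq)
  show "maj_label E ` {..p} \<subseteq> {card {j \<in> E. p < j}..card {j \<in> E. p < j} + p}"
  proof
    fix y assume "y \<in> maj_label E ` {..p}"
    then obtain q where q: "q \<le> p" "y = maj_label E q" by auto
    have "card {j \<in> E. q < j \<and> j \<le> p} \<le> p - q"
      using card_mono[of "{q<..p}" "{j \<in> E. q < j \<and> j \<le> p}"] by (simp add: subset_iff)
    then show "y \<in> {card {j \<in> E. p < j}..card {j \<in> E. p < j} + p}"
      using q card_Collect_split[OF assms q(1)] by (auto simp: maj_label_def)
  qed
  have "inj_on (maj_label E) {..p}" using inj_maj_label[OF assms] by (rule inj_on_subset) simp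
  then show "card (maj_label E ` {..p}) = card {card {j \<in> E. p < j}..card {j \<in> E. p < j} + p}"
    by (simp add: card_image)
qed simp

text \<open>Insertion at \<open>p\<close> shifts the elements beyond \<open>p\<close> but keeps
  their number, which determines the image.\<close>

lemma maj_label_image_insert_descents:
  assumes "finite E"
  shows "maj_label (insert_descents p E) ` {..p} = maj_label E ` {..p}"
proof -
  have "{j \<in> insert_descents p E. p < j} = Suc ` {j \<in> E. p < j}"
    by (auto simp: insert_descents_def)
  moreover have "finite (insert_descents p E)" using assms by (simp add: insert_descents_def)
  ultimately show ?thesis using assms by (simp add: maj_label_image card_image)
qed

text \<open>The descents of the word with the given code, together with the artificial 0. Computing
  them from the code alone makes the labels independent of \<open>n\<close>.\<close>

fun code_descents :: "nat list \<Rightarrow> nat set" where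
  "code_descents [] = {0}"
| "code_descents (a # c) = insert_descents a (code_descents c)"

lemma finite_code_descents: "finite (code_descents c)"
  by (induction c) (auto simp: insert_descents_def)

lemma code_descents_le: "subexcedant c \<Longrightarrow> code_descents c \<subseteq> {..length c}"
  by (induction c) (force simp: insert_descents_def)+

interpretation maj: relabelling "\<lambda>c. maj_label (code_descents c)"
proof
  fix c assume "subexcedant c"
  \<comment> \<open>No descent lies beyond the end of the word, so the interval of labels starts at
    0.\<close>
  then have "card {j \<in> code_descents c. length c < j} = 0"
    using code_descents_le[of c] by (fastforce simp: card_eq_0_iff)
  then have "maj_label (code_descents c) ` {..length c} = {..length c}"
    using maj_label_image[OF finite_code_descents, of c "length c"]
    by (simp add: atLeast0AtMost)
  then show "bij_betw (maj_label (code_descents c)) {..length c} {..length c}"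
    unfolding bij_betw_def using inj_maj_label[OF finite_code_descents, of c] inj_on_subset by blast
qed (simp add: maj_label_image_insert_descents finite_code_descents)

interpretation inv: relabelling "\<lambda>_ a. a"
  by standard (auto simp: bij_betw_def)

section \<open>Permutations as words built from their inversion code\<close>

text \<open>A code of length \<open>m\<close>, with \<open>m\<close> at most \<open>n\<close>,
  builds a word in the letters from \<open>n - m + 1\<close> to \<open>n\<close>; the next letter is
  \<open>n - length c\<close>, smaller than all those present.\<close>

fun build_word :: "nat \<Rightarrow> nat list \<Rightarrow> nat list" where
  "build_word n [] = []"
| "build_word n (a # c) = take a (build_word n c) @ (n - length c) # drop a (build_word n c)"

lemma length_build_word [simp]: "length (build_word n c) = length c"
  by (induction c) auto

lemma set_build_word: "length c \<le> n \<Longrightarrow> set (build_word n c) \<subseteq> {n - length c<..n}"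
proof (induction c)
  case (Cons a c)
  then have IH: "set (build_word n c) \<subseteq> {n - length c<..n}" by simp
  have "set (take a (build_word n c)) \<subseteq> set (build_word n c)"
    "set (drop a (build_word n c)) \<subseteq> set (build_word n c)"
    by (rule set_take_subset set_drop_subset)+
  with IH have "set (take a (build_word n c)) \<union> set (drop a (build_word n c)) \<subseteq> {n - length c<..n}" by blast
  then show ?case using Cons.prems by (fastforce simp: subset_iff)
qed simp

lemma build_word_Cons_less:
  assumes "length c < n" "b \<in> set (take a (build_word n c)) \<union> set (drop a (build_word n c))"
  shows "n - length c < b"
  using assms set_build_word[of c n] set_take_subset[of a "build_word n c"]
    set_drop_subset[of a "build_word n c"] by fastforce

lemma descents_build_word:
  "subexcedant c \<Longrightarrow> length c \<le> n \<Longrightarrow> insert 0 (descents (build_word n c)) = code_descents c"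
proof (induction c)
  case Nil
  then show ?case by (simp add: descents_def)
next
  case (Cons a c)
  then show ?case
    using descents_insert_min[OF build_word_Cons_less[of c n _ a]] by simp
qed

lemma maj_build_word_Cons:
  assumes "subexcedant (a # c)" "length c < n"
  shows "maj (build_word n (a # c)) = maj (build_word n c) + maj_label (code_descents c) a"
  using maj_insert_min[OF build_word_Cons_less[of c n _ a]] assms descents_build_word[of c n] by simp

lemma nth_invcode_card:
  assumes "i \<in> {1..n}"
  shows "invcode n \<tau> ! (i - 1) =
    card {\<tau> j |j k. 1 \<le> j \<and> j < k \<and> k \<le> n \<and> \<tau> k = i \<and> \<tau> j > i}"
proof -
  have "i - 1 < length [1..<Suc n]" "[1..<Suc n] ! (i - 1) = i"
    using assms by (auto simp del: upt_Suc)
  then show ?thesis by (simp only: invcode_def nth_map)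
qed

context
  fixes n :: nat and \<tau> :: "nat \<Rightarrow> nat"
  assumes perm: "\<tau> permutes {1..n}"
begin

lemma length_invcode [simp]: "length (invcode n \<tau>) = n"
  by (simp add: invcode_def)

text \<open>In terms of the inverse, consecutive entries count sets that can be compared by
  inclusion.\<close>

lemma nth_invcode:
  assumes "i \<in> {1..n}"
  shows "invcode n \<tau> ! (i - 1) = card {k \<in> {i<..n}. inv_into UNIV \<tau> k < inv_into UNIV \<tau> i}"
proof -
  have bij: "bij \<tau>" using perm by (rule permutes_bij)
  have mem: "inv_into UNIV \<tau> k \<in> {1..n} \<longleftrightarrow> k \<in> {1..n}" for k
    using permutes_in_image[OF permutes_inv[OF perm]] .
  have "{\<tau> j |j k. 1 \<le> j \<and> j < k \<and> k \<le> n \<and> \<tau> k = i \<and> \<tau> j > i} =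
      {k \<in> {i<..n}. inv_into UNIV \<tau> k < inv_into UNIV \<tau> i}" (is "?A = ?B")
  proof (intro equalityI subsetI)
    fix y assume "y \<in> ?A"
    then obtain j k where *: "y = \<tau> j" "1 \<le> j" "j < k" "k \<le> n" "\<tau> k = i" "\<tau> j > i" by auto
    moreover have "\<tau> j \<in> {1..n}" using permutes_in_image[OF perm, of j] * by simp
    moreover have "inv_into UNIV \<tau> (\<tau> j) = j" "inv_into UNIV \<tau> (\<tau> k) = k" using bij by (simp_all add: bij_is_inj)
    ultimately show "y \<in> ?B" by auto
  next
    fix y assume y: "y \<in> ?B"
    have "\<tau> (inv_into UNIV \<tau> y) = y" "\<tau> (inv_into UNIV \<tau> i) = i" using bij by (simp_all add: bij_is_surj surj_f_inv_f)
    moreover have "inv_into UNIV \<tau> y \<in> {1..n}" "inv_into UNIV \<tau> i \<in> {1..n}" using mem[of y] mem[of i] y assms by simp_all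
    ultimately show "y \<in> ?A" using y
      by (intro CollectI exI[of _ "inv_into UNIV \<tau> y"] exI[of _ "inv_into UNIV \<tau> i"]) auto
  qed
  then show ?thesis using nth_invcode_card[OF assms, of \<tau>] by simp
qed

lemma subexcedant_invcode: "subexcedant (invcode n \<tau>)"
  unfolding subexcedant_nth
proof (intro allI impI)
  fix i assume i: "i < length (invcode n \<tau>)"
  have "card {k \<in> {Suc i<..n}. inv_into UNIV \<tau> k < inv_into UNIV \<tau> (Suc i)} \<le> card {Suc i<..n}"
    by (rule card_mono) auto
  then show "invcode n \<tau> ! i < length (invcode n \<tau>) - i"
    using nth_invcode[of "Suc i"] i by simp
qed

text \<open>If the inverse descends at \<open>j\<close>, the set counted for \<open>j + 1\<close> is
  contained in the one for \<open>j\<close>, which has the further element \<open>j + 1\<close>. An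
  ascent reverses the inclusion.\<close>

lemma descents_invcode: "descents (invcode n \<tau>) = descent_set n (inv_into UNIV \<tau>)"
proof (rule Set.set_eqI)
  fix j
  let ?\<sigma> = "inv_into UNIV \<tau>" and ?A = "\<lambda>i. {k \<in> {i<..n}. inv_into UNIV \<tau> k < inv_into UNIV \<tau> i}"
  show "j \<in> descents (invcode n \<tau>) \<longleftrightarrow> j \<in> descent_set n ?\<sigma>"
  proof (cases "j \<in> {1..n - 1}")
    case True
    then have "invcode n \<tau> ! (j - 1) = card (?A j)" "invcode n \<tau> ! j = card (?A (Suc j))"
      using nth_invcode[of j] nth_invcode[of "Suc j"] by auto
    moreover have "card (?A j) > card (?A (Suc j)) \<longleftrightarrow> ?\<sigma> j > ?\<sigma> (Suc j)"
    proof (cases "?\<sigma> j > ?\<sigma> (Suc j)")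
      case lt: True
      have "?A (Suc j) \<subseteq> ?A j" using lt by auto
      moreover have "Suc j \<in> ?A j" "Suc j \<notin> ?A (Suc j)" using lt True by auto
      ultimately have "?A (Suc j) \<subset> ?A j" by blast
      then show ?thesis using lt by (simp add: psubset_card_mono)
    next
      case False
      have "?\<sigma> j \<noteq> ?\<sigma> (Suc j)"
        using permutes_inj[OF permutes_inv[OF perm]] by (metis injD n_not_Suc_n)
      with False have "?\<sigma> j < ?\<sigma> (Suc j)" by simp
      have "?A j \<subseteq> ?A (Suc j)"
      proof
        fix k assume k: "k \<in> ?A j"
        then have "k \<noteq> Suc j" using \<open>?\<sigma> j < ?\<sigma> (Suc j)\<close> by auto
        then show "k \<in> ?A (Suc j)" using k \<open>?\<sigma> j < ?\<sigma> (Suc j)\<close> by simp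
      qed
      then have "card (?A j) \<le> card (?A (Suc j))" by (simp add: card_mono)
      then show ?thesis using False by simp
    qed
    ultimately show ?thesis using True by (auto simp: descents_def descent_set_def)
  next
    case False
    then show ?thesis by (auto simp: descents_def descent_set_def)
  qed
qed

text \<open>The code entry counts the larger letters to the left of \<open>i\<close>. These are the
  letters preceding \<open>i\<close> after erasure, so the entry is the insertion position.\<close>

lemma erase_below_step:
  assumes "i \<in> {1..n}"
  shows "erase_below i (perm_word n \<tau>) =
    take (invcode n \<tau> ! (i - 1)) (erase_below (Suc i) (perm_word n \<tau>)) @
    i # drop (invcode n \<tau> ! (i - 1)) (erase_below (Suc i) (perm_word n \<tau>))"
proof -
  define k where "k = inv_into UNIV \<tau> i"
  have inj: "inj \<tau>" using perm by (rule permutes_inj)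
  have k: "\<tau> k = i" "k \<in> {1..n}"
    using permutes_surj[OF perm] permutes_in_image[OF permutes_inv[OF perm]] assms
    by (auto simp: k_def surj_f_inv_f)
  define u where "u = map \<tau> [1..<k]"
  define v where "v = map \<tau> [Suc k..<Suc n]"
  have "[1..<Suc n] = [1..<k] @ k # [Suc k..<Suc n]"
    using k(2) upt_add_eq_append[of 1 k "Suc n - k"] upt_conv_Cons[of k "Suc n"] by (simp del: upt_Suc)
  then have w: "perm_word n \<tau> = u @ i # v" by (simp add: perm_word_def u_def v_def k(1) del: upt_Suc)
  have eq_k: "\<tau> j = i \<longleftrightarrow> j = k" for j using inj_eq[OF inj, of j k] k(1) by simp
  have "i \<notin> set u" "i \<notin> set v" using eq_k by (force simp: u_def v_def)+
  then have eq: "filter ((\<le>) i) u = filter ((\<le>) (Suc i)) u" "filter ((\<le>) i) v = filter ((\<le>) (Suc i)) v"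
    by (auto intro!: filter_cong simp: Suc_le_eq le_less)
  have dist: "distinct u" by (simp add: u_def distinct_map inj_on_subset[OF inj])
  have "{\<tau> j |j k. 1 \<le> j \<and> j < k \<and> k \<le> n \<and> \<tau> k = i \<and> \<tau> j > i} = set (filter ((\<le>) (Suc i)) u)"
    using k(2) unfolding eq_k by (auto simp: u_def Suc_le_eq)
  then have "invcode n \<tau> ! (i - 1) = card (set (filter ((\<le>) (Suc i)) u))"
    using nth_invcode_card[OF assms, of \<tau>] by (simp only:)
  then have "invcode n \<tau> ! (i - 1) = length (filter ((\<le>) (Suc i)) u)"
    using dist by (simp add: distinct_card del: set_filter)
  then show ?thesis by (simp add: w erase_below_def eq)
qed

lemma set_perm_word: "set (perm_word n \<tau>) = {1..n}"
  using permutes_image[OF perm]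
  by (simp only: perm_word_def set_map set_upt atLeastLessThanSuc_atLeastAtMost)

lemma erase_below_eq_build_word:
  assumes "i \<le> n"
  shows "erase_below (Suc i) (perm_word n \<tau>) = build_word n (drop i (invcode n \<tau>))"
  using assms
proof (induction i rule: inc_induct)
  case base
  show ?case by (auto simp: erase_below_def filter_empty_conv set_perm_word)
next
  case (step i)
  have "drop i (invcode n \<tau>) = invcode n \<tau> ! i # drop (Suc i) (invcode n \<tau>)"
    using step.hyps by (simp add: Cons_nth_drop_Suc)
  then show ?case using erase_below_step[of "Suc i"] step by simp
qed

lemma perm_word_eq_build_word: "perm_word n \<tau> = build_word n (invcode n \<tau>)"
proof -
  have "perm_word n \<tau> = erase_below (Suc 0) (perm_word n \<tau>)"
    unfolding erase_below_def by (rule filter_True[symmetric]) (simp add: set_perm_word)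
  then show ?thesis using erase_below_eq_build_word[of 0] by simp
qed

text \<open>A majcode entry is the gain in major index from one insertion, which
  \<open>maj_build_word_Cons\<close> identifies with a label.\<close>

lemma majcode_eq_relabel:
  assumes "n \<ge> 1"
  shows "majcode n \<tau> = relabel (\<lambda>c. maj_label (code_descents c)) (invcode n \<tau>)"
proof (rule nth_equalityI)
  let ?c = "invcode n \<tau>"
  show len: "length (majcode n \<tau>) = length (relabel (\<lambda>c. maj_label (code_descents c)) ?c)"
    using assms by (simp add: majcode_def)
  fix i assume "i < length (majcode n \<tau>)"
  then have i: "i < n" using assms by (simp add: majcode_def)
  have drop: "drop i ?c = ?c ! i # drop (Suc i) ?c" using i by (simp add: Cons_nth_drop_Suc)
  have sub: "subexcedant (drop i ?c)"
    using subexcedant_append[of "take i ?c" "drop i ?c"] subexcedant_invcode by simp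
  show "majcode n \<tau> ! i = relabel (\<lambda>c. maj_label (code_descents c)) ?c ! i"
  proof (cases "i < n - 1")
    case True
    then have "majcode n \<tau> ! i = maj (build_word n (drop i ?c)) - maj (build_word n (drop (Suc i) ?c))"
      using erase_below_eq_build_word[of i] erase_below_eq_build_word[of "Suc i"]
      by (simp add: majcode_def nth_append)
    also have "\<dots> = maj_label (code_descents (drop (Suc i) ?c)) (?c ! i)"
      using maj_build_word_Cons[of "?c ! i" "drop (Suc i) ?c" n] sub i unfolding drop by simp
    finally show ?thesis using i by (simp add: nth_relabel)
  next
    case False
    then have "i = n - 1" using i by simp
    \<comment> \<open>The last majcode entry is 0 by convention; this agrees with the label because
      the code entry is 0 and \<open>maj_label {0} 0\<close> is 0.\<close>
    moreover have "?c ! i = 0" using sub i \<open>i = n - 1\<close> unfolding drop by simp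
    ultimately show ?thesis using i by (auto simp: nth_relabel majcode_def nth_append maj_label_def)
  qed
qed

end

section \<open>The inversion code as a bijection onto subexcedant codes\<close>

lemma inj_on_invcode: "inj_on (invcode n) {\<tau>. \<tau> permutes {1..n}}"
proof (rule inj_onI)
  fix \<tau> \<rho> assume "\<tau> \<in> {\<tau>. \<tau> permutes {1..n}}" "\<rho> \<in> {\<tau>. \<tau> permutes {1..n}}"
    and eq: "invcode n \<tau> = invcode n \<rho>"
  then have perm: "\<tau> permutes {1..n}" "\<rho> permutes {1..n}" by auto
  then have "perm_word n \<tau> = perm_word n \<rho>" using eq by (simp add: perm_word_eq_build_word)
  then have "\<tau> x = \<rho> x" if "x \<in> {1..n}" for x
    using that by (auto simp: perm_word_def simp del: upt_Suc)
  then show "\<tau> = \<rho>" using perm by (metis ext permutes_not_in)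
qed

text \<open>Serves to obtain surjectivity of the code by counting instead of by an explicit
  inverse.\<close>

lemma card_subexcedant: "card {c. subexcedant c \<and> length c = n} = fact n"
proof (induction n)
  case 0
  have "{c. subexcedant c \<and> length c = 0} = {[]}" by auto
  then show ?case by simp
next
  case (Suc n)
  have "{c. subexcedant c \<and> length c = Suc n} =
      (\<lambda>(a, c). a # c) ` ({..n} \<times> {c. subexcedant c \<and> length c = n})"
    by (auto simp: length_Suc_conv image_iff)
  then show ?case using Suc by (simp add: card_image inj_on_def card_cartesian_product)
qed

lemma bij_betw_invcode:
  "bij_betw (invcode n) {\<tau>. \<tau> permutes {1..n}} {c. subexcedant c \<and> length c = n}"
  unfolding bij_betw_def
proof (intro conjI inj_on_invcode card_subset_eq finite_subexcedant)
  show "invcode n ` {\<tau>. \<tau> permutes {1..n}} \<subseteq> {c. subexcedant c \<and> length c = n}"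
    by (auto simp: subexcedant_invcode length_invcode)
  show "card (invcode n ` {\<tau>. \<tau> permutes {1..n}}) = card {c. subexcedant c \<and> length c = n}"
    unfolding card_image[OF inj_on_invcode] card_subexcedant by (rule card_permutations) simp_all
qed

text \<open>Inversion permutes the symmetric group, and by \<open>descents_invcode\<close> the code
  of the inverse has the descents of the permutation, so the bijection restricts to the
  class.\<close>

lemma bij_betw_code_class:
  assumes "sum_list I = n"
  shows "bij_betw (\<lambda>\<sigma>. invcode n (inv_into UNIV \<sigma>)) (descent_class n I) (code_class I)"
proof -
  let ?P = "{\<tau>. \<tau> permutes {1..n}}"
  have bij_inv: "bij_betw (inv_into UNIV) ?P ?P"
    by (rule bij_betw_byWitness[where f' = "inv_into UNIV"]) (auto simp: permutes_inv permutes_inv_inv)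
  have bij: "bij_betw (\<lambda>\<sigma>. invcode n (inv_into UNIV \<sigma>)) ?P {c. subexcedant c \<and> length c = n}"
    using bij_betw_trans[OF bij_inv bij_betw_invcode] by (simp add: comp_def)
  have des: "descents (invcode n (inv_into UNIV \<sigma>)) = descent_set n \<sigma>" if "\<sigma> permutes {1..n}" for \<sigma>
    using descents_invcode[OF permutes_inv[OF that]] permutes_inv_inv[OF that] by simp
  have "(\<lambda>\<sigma>. invcode n (inv_into UNIV \<sigma>)) ` descent_class n I = code_class I"
  proof (intro equalityI subsetI)
    fix c assume c: "c \<in> code_class I"
    then have "c \<in> (\<lambda>\<sigma>. invcode n (inv_into UNIV \<sigma>)) ` ?P"
      using bij assms by (auto simp: bij_betw_def code_class_def)
    then show "c \<in> (\<lambda>\<sigma>. invcode n (inv_into UNIV \<sigma>)) ` descent_class n I"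
      using c des by (auto simp: code_class_def descent_class_def)
  next
    fix c assume "c \<in> (\<lambda>\<sigma>. invcode n (inv_into UNIV \<sigma>)) ` descent_class n I"
    then obtain \<sigma> where \<sigma>: "\<sigma> \<in> descent_class n I" "c = invcode n (inv_into UNIV \<sigma>)" by auto
    then have "\<sigma> permutes {1..n}" by (simp add: descent_class_def)
    then show "c \<in> code_class I" using \<sigma> des assms
      by (simp add: code_class_def descent_class_def subexcedant_invcode length_invcode permutes_inv)
  qed
  moreover have "inj_on (\<lambda>\<sigma>. invcode n (inv_into UNIV \<sigma>)) (descent_class n I)"
    using bij by (auto simp: bij_betw_def descent_class_def intro: inj_on_subset)
  ultimately show ?thesis by (simp add: bij_betw_def)
qed

section \<open>Comparing coefficients\<close>

lemma x_seq_eq_single: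
  "x_seq c = Poly_Mapping.single (\<Sum>i\<leftarrow>c. Poly_Mapping.single i 1) 1"
  by (induction c) (auto simp: x_seq_def indet_def Poly_Mapping.mult_single)

lemma lookup_exponent:
  "Poly_Mapping.lookup (\<Sum>i\<leftarrow>c. Poly_Mapping.single i (1::nat)) k = count (mset c) k"
  by (induction c) (auto simp: lookup_add lookup_single when_def)

lemma exponent_eq_iff_mset_eq:
  "(\<Sum>i\<leftarrow>c. Poly_Mapping.single i (1::nat)) = (\<Sum>i\<leftarrow>d. Poly_Mapping.single i 1) \<longleftrightarrow> mset c = mset d"
  by (metis lookup_exponent multiset_eqI poly_mapping_eqI)

text \<open>Each \<open>x_seq (g s)\<close> is one monomial with coefficient 1 that determines the
  multiset of entries, so a coefficient of the sum counts the \<open>s\<close> with a given sorted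
  rearrangement.\<close>

lemma card_sort_eq_coefficient:
  assumes "finite A" "sorted c"
  shows "int (card {s \<in> A. sort (g s) = c}) =
    Poly_Mapping.lookup (\<Sum>s\<in>A. x_seq (g s)) (\<Sum>i\<leftarrow>c. Poly_Mapping.single i 1)"
proof -
  have "sort (g s) = c \<longleftrightarrow> mset (g s) = mset c" for s
    using assms(2) by (metis mset_sort properties_for_sort)
  then have "int (card {s \<in> A. sort (g s) = c}) = (\<Sum>s\<in>A. if mset (g s) = mset c then 1 else 0)"
    using assms(1) by (simp add: sum.If_cases Int_def)
  moreover have "Poly_Mapping.lookup (x_seq (g s)) (\<Sum>i\<leftarrow>c. Poly_Mapping.single i 1) =
      (if mset (g s) = mset c then 1 else 0)" for s
    unfolding x_seq_eq_single lookup_single when_def exponent_eq_iff_mset_eq by simp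
  ultimately show ?thesis by (simp only: lookup_sum)
qed

theorem mainTheorem1:
  fixes n :: nat and I :: "nat list"
  assumes "n \<ge> 1" and "is_composition I n"
  shows "(\<Sum>\<sigma>\<in>descent_class n I. x_seq (majcode n (inv_into UNIV \<sigma>))) =
           (\<Sum>\<sigma>\<in>descent_class n I. x_seq (invcode n (inv_into UNIV \<sigma>))) \<and>
         (\<Sum>\<sigma>\<in>descent_class n I. x_seq (invcode n (inv_into UNIV \<sigma>))) = flagged_ribbon n I \<and>
         (\<forall>c. card {\<sigma> \<in> descent_class n I. sort (majcode n (inv_into UNIV \<sigma>)) = c} =
              card {\<sigma> \<in> descent_class n I. sort (invcode n (inv_into UNIV \<sigma>)) = c})"
proof -
  let ?D = "descent_class n I"
  have I: "I \<noteq> []" "\<forall>i\<in>set I. 1 \<le> i" "sum_list I = n"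
    using assms by (auto simp: is_composition_def)
  have bij: "bij_betw (\<lambda>\<sigma>. invcode n (inv_into UNIV \<sigma>)) ?D (code_class I)"
    using bij_betw_code_class[OF I(3)] .
  have fin: "finite ?D"
    using bij_betw_finite[OF bij] finite_code_class by simp
  have "(\<Sum>\<sigma>\<in>?D. x_seq (majcode n (inv_into UNIV \<sigma>))) =
      (\<Sum>\<sigma>\<in>?D. x_seq (relabel (\<lambda>c. maj_label (code_descents c)) (invcode n (inv_into UNIV \<sigma>))))"
    using assms(1) by (intro sum.cong) (auto simp: descent_class_def majcode_eq_relabel permutes_inv)
  also have "\<dots> = flagged_ribbon n I"
    using sum.reindex_bij_betw[OF bij, of "\<lambda>c. x_seq (relabel (\<lambda>c. maj_label (code_descents c)) c)"]
      maj.sum_code_class[OF I(1,2)] I(3) by simp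
  finally have M: "(\<Sum>\<sigma>\<in>?D. x_seq (majcode n (inv_into UNIV \<sigma>))) = flagged_ribbon n I" .
  have N: "(\<Sum>\<sigma>\<in>?D. x_seq (invcode n (inv_into UNIV \<sigma>))) = flagged_ribbon n I"
    using sum.reindex_bij_betw[OF bij, of x_seq] inv.sum_code_class[OF I(1,2)] I(3)
    by (simp add: relabel_id)
  have "card {\<sigma> \<in> ?D. sort (majcode n (inv_into UNIV \<sigma>)) = c} = card {\<sigma> \<in> ?D. sort (invcode n (inv_into UNIV \<sigma>)) = c}" for c
  proof (cases "sorted c")
    case True
    then show ?thesis
      using card_sort_eq_coefficient[OF fin True, of "\<lambda>\<sigma>. majcode n (inv_into UNIV \<sigma>)"]
        card_sort_eq_coefficient[OF fin True, of "\<lambda>\<sigma>. invcode n (inv_into UNIV \<sigma>)"] M N by simp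
  next
    case False
    then have "sort w \<noteq> c" for w by auto
    then show ?thesis by simp
  qed
  then show ?thesis using M N by simp
qed

end
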